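(* Let $\mathcal{X} \subseteq \mathbb{R}^d$, let $\{f_\phi : \mathcal{X} \to \mathbb{R}^m\}_{\phi \in \Phi}$ be a family of functions, and let $\{\omega(\cdot;\eta)\}_{\eta \in \Pi}$ be a family of probability density functions on $\mathbb{R}^m$. Write $\psi = (\phi,\eta) \in \Psi = \Phi \times \Pi$. Assume that (i) there is a constant $L_f$, not depending on $\phi$, such that $f_\phi$ is $L_f$-Lipschitz for every $\phi \in \Phi$; (ii) $\sup_{\eta \in \Pi} \mathbb{E}_{\mathbf{t} \sim \omega(\mathbf{t};\eta)}[\|\mathbf{t}\|] < \infty$. For a probability distribution $\mathbb{P}$ on $\mathcal{X}$, let $\mathbb{P}^{(\phi)}$ denote the distribution of $f_\phi(\mathbf{x})$ when $\mathbf{x} \sim \mathbb{P}$, and similarly let $\mathbb{P}_n^{(\phi)}$ denote the distribution of $f_\phi(\mathbf{x})$ when $\mathbf{x} \sim \mathbb{P}_n$. Then $\sup_{\psi \in \Psi} \mathrm{CFD}_{\omega}^2(\mathbb{P}_n^{(\phi)}, \mathbb{P}^{(\phi)})$ is continuous in the weak topology, i.e., for any probability distributions $\mathbb{P}$ and $(\mathbb{P}_n)_{n \ge 1}$ on $\mathcal{X}$, if $\mathbb{P}_n \to \mathbb{P}$ in distribution as $n \to \infty$, then $$\sup_{\psi \in \Psi} \mathrm{CFD}_{\omega}^2\big(\mathbb{P}_n^{(\phi)}, \mathbb{P}^{(\phi)}\big) \to 0 \quad \text{as } n \to \infty.$$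
   Context: For a probability distribution $\mathbb{P}$ on $\mathbb{R}^m$, its characteristic function is $\varphi_{\mathbb{P}}(\mathbf{t}) = \mathbb{E}_{\mathbf{x} \sim \mathbb{P}}[e^{i \langle \mathbf{t}, \mathbf{x}\rangle}]$, $\mathbf{t} \in \mathbb{R}^m$. For two probability distributions $\mathbb{P}, \mathbb{Q}$ on $\mathbb{R}^m$ and a probability density $\omega(\cdot;\eta)$ on $\mathbb{R}^m$ with parameter $\eta$, the squared characteristic function distance is $$\mathrm{CFD}_{\omega}^2(\mathbb{P},\mathbb{Q}) = \mathbb{E}_{\mathbf{t} \sim \omega(\mathbf{t};\eta)}\big[|\varphi_{\mathbb{P}}(\mathbf{t}) - \varphi_{\mathbb{Q}}(\mathbf{t})|^2\big] = \int_{\mathbb{R}^m} |\varphi_{\mathbb{P}}(\mathbf{t}) - \varphi_{\mathbb{Q}}(\mathbf{t})|^2\, \omega(\mathbf{t};\eta)\, d\mathbf{t}.$$ It depends on $\eta$ through $\omega$. All norms are Euclidean, and Lipschitz is with respect to Euclidean norms. *)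

theory Defs
  imports "HOL-Probability.Probability"
begin

text \<open>A probability distribution on \<open>X\<close> lives on the trace of the Borel sigma-algebra, which is
  the Borel sigma-algebra of the subspace \<open>X\<close>; the set \<open>X\<close> itself need not be Borel.\<close>

definition prob_dist_on :: "'a::topological_space set \<Rightarrow> 'a measure \<Rightarrow> bool" where
  "prob_dist_on X P \<longleftrightarrow> prob_space P \<and> sets P = sets (restrict_space borel X)"

text \<open>The library's weak convergence covers measures on the real line only. This is the usual
  definition by bounded continuous test functions on the space \<open>X\<close>.\<close>

definition weak_conv_on ::
    "'a::topological_space set \<Rightarrow> (nat \<Rightarrow> 'a measure) \<Rightarrow> 'a measure \<Rightarrow> bool" where
  "weak_conv_on X Ps P \<longleftrightarrow>
     (\<forall>g :: 'a \<Rightarrow> real. continuous_on X g \<longrightarrow> bounded (g ` X) \<longrightarrow>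
        (\<lambda>n. \<integral>x. g x \<partial>Ps n) \<longlonglongrightarrow> (\<integral>x. g x \<partial>P))"

definition prob_density :: "('b::euclidean_space \<Rightarrow> real) \<Rightarrow> bool" where
  "prob_density w \<longleftrightarrow>
     w \<in> borel_measurable borel \<and> (\<forall>t. 0 \<le> w t) \<and> (\<integral>\<^sup>+ t. ennreal (w t) \<partial>lborel) = 1"

definition density_dist :: "('b::euclidean_space \<Rightarrow> real) \<Rightarrow> 'b measure" where
  "density_dist w = density lborel (\<lambda>t. ennreal (w t))"

text \<open>The vector analogue of the library's \<^const>\<open>char\<close>.\<close>

definition char_vec :: "'b::euclidean_space measure \<Rightarrow> 'b \<Rightarrow> complex" where
  "char_vec P t = (CLINT x|P. iexp (t \<bullet> x))"

text \<open>Expectations of nonnegative quantities are taken in the extended nonnegative reals, so that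
  neither they nor their suprema need side conditions.\<close>

definition cfd_sq ::
    "('b::euclidean_space \<Rightarrow> real) \<Rightarrow> 'b measure \<Rightarrow> 'b measure \<Rightarrow> ennreal" where
  "cfd_sq w P Q =
     (\<integral>\<^sup>+ t. ennreal ((cmod (char_vec P t - char_vec Q t))\<^sup>2) \<partial>density_dist w)"

end

theory Submission
  imports Defs
begin

text \<open>Weak convergence of probability measures on a separable metric space is uniform over test
  functions that are bounded by \<open>1\<close> and share a Lipschitz constant: up to a set of small mass, such
  functions are approximated by combinations of the same finitely many bump functions. Tightness is
  not available, because \<open>X\<close> need not be closed or even Borel; separability replaces it. The functions
  \<open>x \<mapsto> exp (i t \<bullet> f x)\<close> have Lipschitz constant \<open>L * norm t\<close>, so the distance of the characteristic
  functions is at most \<open>e * (1 + L * norm t)\<close>, and since it never exceeds \<open>2\<close> its square is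
  controlled by the first moment of the weight.\<close>

section \<open>Measurability and integrability of continuous functions on \<open>X\<close>\<close>

lemma borel_measurable_prob_dist_on:
  assumes "prob_dist_on X P" "continuous_on X g"
  shows "g \<in> borel_measurable P"
  using borel_measurable_continuous_on_restrict[OF assms(2)] assms(1)
  by (simp add: prob_dist_on_def cong: measurable_cong_sets)

lemma space_prob_dist_on: "prob_dist_on X P \<Longrightarrow> space P = X"
  using sets_eq_imp_space_eq[of P "restrict_space borel X"]
  by (simp add: prob_dist_on_def space_restrict_space)

lemma integrable_prob_dist_on:
  fixes g :: "'a::topological_space \<Rightarrow> 'b::{banach, second_countable_topology}"
  assumes P: "prob_dist_on X P" and "continuous_on X g" and "\<And>x. x \<in> X \<Longrightarrow> norm (g x) \<le> B"
  shows "integrable P g"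
proof -
  interpret prob_space P using P by (simp add: prob_dist_on_def)
  show ?thesis
    using assms by (intro integrable_const_bound[where B = B])
      (auto simp: space_prob_dist_on intro: borel_measurable_prob_dist_on)
qed

section \<open>Approximate partitions of unity and uniform weak convergence\<close>

lemma sum_telescoping_prod:
  fixes c :: "nat \<Rightarrow> 'a::comm_ring_1"
  shows "(\<Sum>i<N. c i * (\<Prod>j<i. 1 - c j)) = 1 - (\<Prod>j<N. 1 - c j)"
  by (induction N) (auto simp: algebra_simps)

text \<open>Bumps \<open>c i\<close> around a dense sequence are made to share the unit mass
  greedily: the \<open>i\<close>-th function takes the fraction \<open>c i\<close> of what its
  predecessors left over. Every point of \<open>X\<close> is eventually used up, so the leftover has
  small integral for large \<open>N\<close>. The functions are continuous so that weak convergence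
  can test against them.\<close>

lemma approximate_partition_of_unity:
  fixes X :: "'a::{metric_space, second_countable_topology} set"
  assumes P: "prob_dist_on X P" and "\<delta> > 0" and "e > 0"
  obtains N and y :: "nat \<Rightarrow> 'a" and \<psi> :: "nat \<Rightarrow> 'a \<Rightarrow> real" where
    "\<And>i. y i \<in> X" "\<And>i. continuous_on X (\<psi> i)" "\<And>i x. 0 \<le> \<psi> i x"
    "\<And>x. (\<Sum>i<N. \<psi> i x) \<le> 1" "\<And>i x. \<psi> i x \<noteq> 0 \<Longrightarrow> dist x (y i) \<le> \<delta>"
    "(\<integral>x. 1 - (\<Sum>i<N. \<psi> i x) \<partial>P) < e"
proof -
  interpret prob_space P using P by (simp add: prob_dist_on_def)
  have "X \<noteq> {}" using not_empty space_prob_dist_on[OF P] by simp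
  obtain T where T: "countable T" "T \<subseteq> X" "X \<subseteq> closure T"
    using separable by blast
  with \<open>X \<noteq> {}\<close> have "T \<noteq> {}" by auto
  \<comment> \<open>If \<open>T\<close> is finite, the enumeration repeats points, which is
    harmless.\<close>
  define y where "y = from_nat_into T"
  have yT: "y i \<in> T" for i using \<open>T \<noteq> {}\<close> by (simp add: y_def from_nat_into)
  \<comment> \<open>The bump is 1 up to distance \<delta>/2 from \<open>y i\<close>, falls linearly
    and is 0 from distance \<delta> on; \<open>r N\<close> is what the first \<open>N\<close> bumps
    leave over.\<close>
  define c where "c = (\<lambda>i x. max 0 (min 1 (2 - 2 * dist x (y i) / \<delta>)))"
  define r where "r = (\<lambda>N x. \<Prod>j<N. 1 - c j x)"
  have c01: "0 \<le> c i x" "c i x \<le> 1" for i x by (auto simp: c_def)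
  have cont_c: "continuous_on X (c i)" for i
    unfolding c_def using \<open>\<delta> > 0\<close> by (intro continuous_intros) auto
  have cont_r: "continuous_on X (r N)" for N
    unfolding r_def by (intro continuous_intros cont_c)
  have r01: "0 \<le> r N x" "r N x \<le> 1" for N x
    unfolding r_def using c01 by (auto intro!: prod_nonneg prod_le_1)
  have supp: "dist x (y i) \<le> \<delta>" if "c i x \<noteq> 0" for i x
    using that \<open>\<delta> > 0\<close> by (auto simp: c_def max_def min_def field_simps split: if_splits)
  have r_lim: "(\<lambda>N. r N x) \<longlonglongrightarrow> 0" if "x \<in> X" for x
  proof -
    have "x \<in> closure T" using that T by auto
    then obtain z where "z \<in> T" "dist z x < \<delta> / 2"
      using \<open>\<delta> > 0\<close> closure_approachable half_gt_zero by blast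
    moreover obtain k where "y k = z"
      using from_nat_into_surj[OF T(1) \<open>z \<in> T\<close>] by (auto simp: y_def)
    ultimately have "c k x = 1"
      using \<open>\<delta> > 0\<close> by (auto simp: c_def dist_commute field_simps min_def)
    \<comment> \<open>Since \<open>x\<close> lies on the plateau of bump \<open>k\<close>, the
      factor at \<open>j = k\<close> is 0, so the product vanishes exactly.\<close>
    then have "r N x = 0" if "k < N" for N
      unfolding r_def using that by (intro prod_zero) auto
    then have "\<forall>\<^sub>F N in sequentially. r N x = 0"
      by (intro eventually_mono[OF eventually_gt_at_top[of k]])
    then show ?thesis by (rule tendsto_eventually)
  qed
  have "(\<lambda>N. \<integral>x. r N x \<partial>P) \<longlonglongrightarrow> (\<integral>x. 0 \<partial>P)"
  proof (rule integral_dominated_convergence[where w = "\<lambda>_. 1"])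
    show "AE x in P. (\<lambda>N. r N x) \<longlonglongrightarrow> 0"
      using r_lim by (intro AE_I2) (simp add: space_prob_dist_on[OF P])
  qed (use r01 cont_r in \<open>auto intro: borel_measurable_prob_dist_on[OF P]\<close>)
  then have "\<forall>\<^sub>F N in sequentially. (\<integral>x. r N x \<partial>P) < e"
    using \<open>e > 0\<close> by (intro order_tendstoD(2)[where y = "\<integral>x. 0 \<partial>P"]) auto
  then obtain N where N: "(\<integral>x. r N x \<partial>P) < e"
    by (auto simp: eventually_sequentially)
  have sum_eq: "(\<Sum>i<N. c i x * (\<Prod>j<i. 1 - c j x)) = 1 - r N x" for x
    unfolding r_def by (rule sum_telescoping_prod)
  show thesis
  proof (rule that[of y "\<lambda>i x. c i x * (\<Prod>j<i. 1 - c j x)" N])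
    show "continuous_on X (\<lambda>x. c i x * (\<Prod>j<i. 1 - c j x))" for i
      by (intro continuous_intros cont_c)
    show "0 \<le> c i x * (\<Prod>j<i. 1 - c j x)" for i x
      using c01 by (auto intro!: mult_nonneg_nonneg prod_nonneg)
  qed (use yT T(2) r01 N supp in \<open>auto simp: sum_eq\<close>)
qed

text \<open>Where \<open>\<psi> i\<close> lives, \<open>g\<close> differs from
  \<open>g (y i)\<close> by at most \<open>\<delta> * K\<close>; on the leftover mass only
  \<open>norm (g x) \<le> 1\<close> is available. The approximating sum sees \<open>Q\<close> only
  through finitely many integrals that do not involve \<open>g\<close>.\<close>

lemma norm_integral_diff_partition_sum_le:
  fixes g :: "'a::metric_space \<Rightarrow> 'b::{banach, second_countable_topology}" and N :: nat
  assumes Q: "prob_dist_on X Q"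
    and y: "\<And>i. y i \<in> X" and cont: "\<And>i. continuous_on X (\<psi> i)"
    and nonneg: "\<And>i x. (0::real) \<le> \<psi> i x"
    and le1: "\<And>x. (\<Sum>i<N. \<psi> i x) \<le> 1"
    and supp: "\<And>i x. \<psi> i x \<noteq> 0 \<Longrightarrow> dist x (y i) \<le> \<delta>"
    and lip: "K-lipschitz_on X g" and bound: "\<And>x. x \<in> X \<Longrightarrow> norm (g x) \<le> 1"
    and "\<delta> \<ge> 0"
  shows "norm ((\<integral>x. g x \<partial>Q) - (\<Sum>i<N. (\<integral>x. \<psi> i x \<partial>Q) *\<^sub>R g (y i)))
           \<le> \<delta> * K + (\<integral>x. 1 - (\<Sum>i<N. \<psi> i x) \<partial>Q)"
proof -
  interpret prob_space Q using Q by (simp add: prob_dist_on_def)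
  have "K \<ge> 0" using lip by (rule lipschitz_on_nonneg)
  have \<psi>_int: "integrable Q (\<psi> i)" if "i < N" for i
  proof (rule integrable_prob_dist_on[OF Q cont])
    have "\<psi> i x \<le> (\<Sum>i<N. \<psi> i x)" for x
      using that nonneg by (intro member_le_sum) auto
    then show "norm (\<psi> i x) \<le> 1" for x
      using nonneg le1[of x] by (auto intro: order_trans)
  qed
  have g_int: "integrable Q g"
    using bound lip by (intro integrable_prob_dist_on[OF Q] lipschitz_on_continuous_on)
  have sum_int: "integrable Q (\<lambda>x. \<Sum>i<N. \<psi> i x)"
    using \<psi>_int by (intro Bochner_Integration.integrable_sum) auto
  have appr_int: "integrable Q (\<lambda>x. \<Sum>i<N. \<psi> i x *\<^sub>R g (y i))"
    using \<psi>_int by (intro Bochner_Integration.integrable_sum integrable_scaleR_left) auto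
  have pointwise: "norm (g x - (\<Sum>i<N. \<psi> i x *\<^sub>R g (y i))) \<le> \<delta> * K + (1 - (\<Sum>i<N. \<psi> i x))"
    if "x \<in> X" for x
  proof -
    let ?s = "\<Sum>i<N. \<psi> i x"
    have s0: "0 \<le> ?s" using nonneg by (intro sum_nonneg) auto
    \<comment> \<open>Split \<open>g x\<close> into the part weighted by the partition and the part
      weighted by the leftover.\<close>
    have "g x - (\<Sum>i<N. \<psi> i x *\<^sub>R g (y i)) = (\<Sum>i<N. \<psi> i x *\<^sub>R (g x - g (y i))) + (1 - ?s) *\<^sub>R g x"
      by (simp add: scaleR_diff_right sum_subtractf scaleR_sum_left algebra_simps)
    also have "norm \<dots> \<le> (\<Sum>i<N. norm (\<psi> i x *\<^sub>R (g x - g (y i)))) + norm ((1 - ?s) *\<^sub>R g x)"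
      by (intro norm_triangle_le add_mono norm_sum) auto
    also have "(\<Sum>i<N. norm (\<psi> i x *\<^sub>R (g x - g (y i)))) \<le> (\<Sum>i<N. \<psi> i x * (\<delta> * K))"
    proof (rule sum_mono)
      fix i
      show "norm (\<psi> i x *\<^sub>R (g x - g (y i))) \<le> \<psi> i x * (\<delta> * K)"
      proof (cases "\<psi> i x = 0")
        case False
        have "norm (g x - g (y i)) \<le> K * dist x (y i)"
          using lipschitz_onD[OF lip that y] by (simp add: dist_norm)
        also have "\<dots> \<le> \<delta> * K"
          using mult_left_mono[OF supp[OF False] \<open>K \<ge> 0\<close>] by (simp add: mult.commute)
        finally show ?thesis using nonneg by (auto intro: mult_left_mono)
      qed auto
    qed
    also have "(\<Sum>i<N. \<psi> i x * (\<delta> * K)) \<le> \<delta> * K"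
      using mult_right_mono[OF le1[of x], of "\<delta> * K"] \<open>\<delta> \<ge> 0\<close> \<open>K \<ge> 0\<close>
      by (simp add: sum_distrib_right)
    also have "norm ((1 - ?s) *\<^sub>R g x) \<le> 1 - ?s"
      using bound[OF that] le1[of x] by (simp add: mult_left_le)
    finally show ?thesis by simp
  qed
  have "(\<integral>x. g x \<partial>Q) - (\<Sum>i<N. (\<integral>x. \<psi> i x \<partial>Q) *\<^sub>R g (y i))
      = (\<integral>x. g x - (\<Sum>i<N. \<psi> i x *\<^sub>R g (y i)) \<partial>Q)"
    using g_int appr_int \<psi>_int by (simp add: Bochner_Integration.integral_sum)
  also have "norm \<dots> \<le> (\<integral>x. \<delta> * K + (1 - (\<Sum>i<N. \<psi> i x)) \<partial>Q)"
    using pointwise g_int appr_int sum_int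
    by (intro order_trans[OF integral_norm_bound integral_mono])
      (auto simp: space_prob_dist_on[OF Q])
  also have "\<dots> = \<delta> * K + (\<integral>x. 1 - (\<Sum>i<N. \<psi> i x) \<partial>Q)"
    using sum_int by (simp add: prob_space)
  finally show ?thesis .
qed

text \<open>The partition depends only on \<open>P\<close> and \<open>e\<close>, so the threshold
  for \<open>n\<close> comes from finitely many test functions fixed before \<open>g\<close> and
  \<open>K\<close>. Letting \<open>K\<close> vary inside the bound allows it to grow with the
  frequency \<open>t\<close> later.\<close>

lemma weak_conv_on_uniform_lipschitz:
  fixes X :: "'a::{metric_space, second_countable_topology} set"
  assumes P: "prob_dist_on X P" and Ps: "\<And>n. n \<ge> 1 \<Longrightarrow> prob_dist_on X (Ps n)"
    and conv: "weak_conv_on X Ps P" and "e > 0"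
  shows "\<forall>\<^sub>F n in sequentially.
    \<forall>(g :: 'a \<Rightarrow> 'b::{banach, second_countable_topology}) K.
      K-lipschitz_on X g \<longrightarrow> (\<forall>x\<in>X. norm (g x) \<le> 1) \<longrightarrow>
      norm ((\<integral>x. g x \<partial>Ps n) - (\<integral>x. g x \<partial>P)) \<le> e * (1 + K)"
proof -
  obtain N :: nat and y :: "nat \<Rightarrow> 'a" and \<psi> where
    y: "\<And>i. y i \<in> X" and cont: "\<And>i. continuous_on X (\<psi> i)"
    and nonneg: "\<And>i x. (0::real) \<le> \<psi> i x" and le1: "\<And>x. (\<Sum>i<N. \<psi> i x) \<le> 1"
    and supp: "\<And>i x. \<psi> i x \<noteq> 0 \<Longrightarrow> dist x (y i) \<le> e / 4"
    and small: "(\<integral>x. 1 - (\<Sum>i<N. \<psi> i x) \<partial>P) < e / 4"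
    using approximate_partition_of_unity[OF P, of "e / 4" "e / 4"] \<open>e > 0\<close>
    by (metis divide_pos_pos zero_less_numeral)
  let ?r = "\<lambda>x. 1 - (\<Sum>i<N. \<psi> i x)"
  have \<psi>1: "\<psi> i x \<le> 1" if "i < N" for i x
    using order_trans[OF member_le_sum[of i "{..<N}" "\<lambda>i. \<psi> i x"] le1[of x]] that nonneg by auto
  have conv_\<psi>: "(\<lambda>n. \<integral>x. \<psi> i x \<partial>Ps n) \<longlonglongrightarrow> (\<integral>x. \<psi> i x \<partial>P)" if "i < N" for i
  proof -
    have "bounded (\<psi> i ` X)"
      using nonneg \<psi>1[OF that] by (auto simp: bounded_iff intro!: exI[of _ "1::real"])
    then show ?thesis using conv cont by (auto simp: weak_conv_on_def)
  qed
  \<comment> \<open>The leftover is itself a bounded continuous test function, so its smallness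
    under \<open>P\<close> passes to \<open>Ps n\<close> for large \<open>n\<close>.\<close>
  have conv_r: "(\<lambda>n. \<integral>x. ?r x \<partial>Ps n) \<longlonglongrightarrow> (\<integral>x. ?r x \<partial>P)"
  proof -
    have "continuous_on X ?r" by (intro continuous_intros cont)
    moreover have "bounded (?r ` X)"
      using le1 nonneg by (auto simp: bounded_iff intro!: exI[of _ "1::real"] sum_nonneg)
    ultimately show ?thesis using conv by (auto simp: weak_conv_on_def)
  qed
  have "(\<lambda>n. \<Sum>i<N. \<bar>(\<integral>x. \<psi> i x \<partial>Ps n) - (\<integral>x. \<psi> i x \<partial>P)\<bar>) \<longlonglongrightarrow> (\<Sum>i<N. 0)"
    using conv_\<psi> by (intro tendsto_sum tendsto_rabs_zero LIM_zero) auto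
  then have "\<forall>\<^sub>F n in sequentially. (\<Sum>i<N. \<bar>(\<integral>x. \<psi> i x \<partial>Ps n) - (\<integral>x. \<psi> i x \<partial>P)\<bar>) < e / 4"
    using \<open>e > 0\<close> by (intro order_tendstoD(2)) auto
  moreover have "\<forall>\<^sub>F n in sequentially. (\<integral>x. ?r x \<partial>Ps n) < e / 4"
    using order_tendstoD(2)[OF conv_r small] .
  \<comment> \<open>Index 0 is excluded because nothing is assumed about
    \<open>Ps 0\<close>.\<close>
  ultimately show ?thesis
    using eventually_ge_at_top[of 1]
  proof eventually_elim
    case (elim n)
    show ?case
    proof (intro allI impI)
      fix g :: "'a \<Rightarrow> 'b" and K
      assume lip: "K-lipschitz_on X g" and bound: "\<forall>x\<in>X. norm (g x) \<le> 1"
      have "K \<ge> 0" using lip by (rule lipschitz_on_nonneg)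
      define S where "S = (\<lambda>Q. \<Sum>i<N. (\<integral>x. \<psi> i x \<partial>Q) *\<^sub>R g (y i))"
      have est: "norm ((\<integral>x. g x \<partial>Q) - S Q) \<le> e / 4 * K + (\<integral>x. ?r x \<partial>Q)"
        if "prob_dist_on X Q" for Q
        unfolding S_def using that y cont nonneg le1 supp lip bound \<open>e > 0\<close>
        by (intro norm_integral_diff_partition_sum_le) auto
      have "norm (S (Ps n) - S P)
          = norm (\<Sum>i<N. ((\<integral>x. \<psi> i x \<partial>Ps n) - (\<integral>x. \<psi> i x \<partial>P)) *\<^sub>R g (y i))"
        by (simp add: S_def scaleR_diff_left sum_subtractf)
      also have "\<dots> \<le> (\<Sum>i<N. \<bar>(\<integral>x. \<psi> i x \<partial>Ps n) - (\<integral>x. \<psi> i x \<partial>P)\<bar>)"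
        using bound y by (intro sum_norm_le) (auto intro: mult_left_le)
      finally have "norm (S (Ps n) - S P) \<le> e / 4" using elim(1) by simp
      moreover have "norm ((\<integral>x. g x \<partial>Ps n) - S (Ps n)) \<le> e / 4 * K + e / 4"
        using est[OF Ps[OF elim(3)]] elim(2) by simp
      moreover have "norm (S P - (\<integral>x. g x \<partial>P)) \<le> e / 4 * K + e / 4"
        using est[OF P] small by (simp add: norm_minus_commute)
      moreover have "norm ((\<integral>x. g x \<partial>Ps n) - (\<integral>x. g x \<partial>P)) \<le>
          norm ((\<integral>x. g x \<partial>Ps n) - S (Ps n)) + norm (S (Ps n) - S P) + norm (S P - (\<integral>x. g x \<partial>P))"
        by norm
      \<comment> \<open>The three differences add up to \<open>e * K / 2 + 3 * e / 4\<close>;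
        nonnegativity of \<open>e * K\<close> absorbs the slack.\<close>
      moreover have "0 \<le> e * K" using \<open>e > 0\<close> \<open>K \<ge> 0\<close> by simp
      ultimately show "norm ((\<integral>x. g x \<partial>Ps n) - (\<integral>x. g x \<partial>P)) \<le> e * (1 + K)"
        using \<open>e > 0\<close> by (simp add: algebra_simps)
    qed
  qed
qed

section \<open>Characteristic functions and a linear bound on the squared distance\<close>

lemma lipschitz_on_iexp: "1-lipschitz_on UNIV (\<lambda>s::real. iexp s)"
proof (rule lipschitz_onI)
  fix s u :: real
  \<comment> \<open>Factoring out a number of modulus 1 leaves the zeroth-order Taylor remainder of
    \<open>iexp\<close> at \<open>s - u\<close>.\<close>
  have "iexp s - iexp u = iexp u * (iexp (s - u) - 1)"
    by (simp add: algebra_simps flip: exp_add)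
  then have "cmod (iexp s - iexp u) = cmod (iexp (s - u) - 1)"
    by (simp add: norm_mult)
  also have "\<dots> \<le> \<bar>s - u\<bar>"
    using iexp_approx1[of "s - u" 0] by simp
  finally show "dist (iexp s) (iexp u) \<le> 1 * dist s u" by (simp add: dist_norm)
qed simp

lemma lipschitz_on_iexp_inner:
  fixes h :: "'a::metric_space \<Rightarrow> 'b::real_inner"
  assumes h: "L-lipschitz_on X h"
  shows "(L * norm t)-lipschitz_on X (\<lambda>x. iexp (t \<bullet> h x))"
proof (rule lipschitz_onI)
  show "0 \<le> L * norm t" using lipschitz_on_nonneg[OF h] by simp
next
  fix x y assume "x \<in> X" "y \<in> X"
  have "dist (iexp (t \<bullet> h x)) (iexp (t \<bullet> h y)) \<le> \<bar>t \<bullet> (h x - h y)\<bar>"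
    using lipschitz_onD[OF lipschitz_on_iexp, of "t \<bullet> h x" "t \<bullet> h y"]
    by (simp add: dist_norm inner_diff_right)
  also have "\<dots> \<le> norm t * norm (h x - h y)" by (rule Cauchy_Schwarz_ineq2)
  also have "\<dots> \<le> norm t * (L * dist x y)"
    using lipschitz_onD[OF h \<open>x \<in> X\<close> \<open>y \<in> X\<close>] by (intro mult_left_mono) (auto simp: dist_norm)
  finally show "dist (iexp (t \<bullet> h x)) (iexp (t \<bullet> h y)) \<le> L * norm t * dist x y"
    by (simp add: mult_ac)
qed

text \<open>Pulls the integral back to the original space, where all push-forwards are tested
  against the same weakly convergent sequence.\<close>

lemma char_vec_distr:
  assumes "h \<in> borel_measurable Q"
  shows "char_vec (distr Q borel h) t = (CLINT x|Q. iexp (t \<bullet> h x))"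
  unfolding char_vec_def by (rule integral_distr[OF assms]) measurable

lemma cmod_char_vec_le_1:
  assumes "prob_space Q"
  shows "cmod (char_vec Q t) \<le> 1"
proof -
  interpret prob_space Q by fact
  have "cmod (char_vec Q t) \<le> (\<integral>x. cmod (iexp (t \<bullet> x)) \<partial>Q)"
    unfolding char_vec_def by (rule integral_norm_bound)
  then show ?thesis by (simp add: prob_space)
qed

text \<open>A difference of characteristic functions has modulus at most 2, so its square is at most
  twice its modulus. This keeps the integrand linear in \<open>norm t\<close>, and a first moment
  suffices; squaring the bound itself would call for a second moment.\<close>

lemma cfd_sq_le:
  assumes w: "prob_density w" and Q: "prob_space Q" and R: "prob_space R"
    and "a \<ge> 0" "b \<ge> 0"
    and bound: "\<And>t. cmod (char_vec Q t - char_vec R t) \<le> a + b * norm t"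
  shows "cfd_sq w Q R \<le> ennreal (2 * a) + ennreal (2 * b) * (\<integral>\<^sup>+ t. ennreal (norm t) \<partial>density_dist w)"
proof -
  have meas[measurable]: "w \<in> borel_measurable borel"
    using w by (simp add: prob_density_def)
  have meas_norm: "(\<lambda>t. ennreal (norm t)) \<in> borel_measurable (density_dist w)"
    unfolding density_dist_def by measurable
  have total: "emeasure (density_dist w) (space (density_dist w)) = 1"
    using w by (simp add: density_dist_def emeasure_density prob_density_def)
  have "(cmod (char_vec Q t - char_vec R t))\<^sup>2 \<le> 2 * a + 2 * b * norm t" for t
  proof -
    have "cmod (char_vec Q t - char_vec R t) \<le> 2"
      using norm_triangle_ineq4[of "char_vec Q t" "char_vec R t"]
        cmod_char_vec_le_1[OF Q, of t] cmod_char_vec_le_1[OF R, of t] by linarith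
    then have "(cmod (char_vec Q t - char_vec R t))\<^sup>2 \<le> 2 * (a + b * norm t)"
      unfolding power2_eq_square using bound by (intro mult_mono) auto
    then show ?thesis by (simp add: algebra_simps)
  qed
  then have "cfd_sq w Q R \<le> (\<integral>\<^sup>+ t. ennreal (2 * a) + ennreal (2 * b) * ennreal (norm t) \<partial>density_dist w)"
    unfolding cfd_sq_def using \<open>a \<ge> 0\<close> \<open>b \<ge> 0\<close>
    by (intro nn_integral_mono) (simp flip: ennreal_plus ennreal_mult add: ennreal_leI)
  also have "\<dots> = ennreal (2 * a) + ennreal (2 * b) * (\<integral>\<^sup>+ t. ennreal (norm t) \<partial>density_dist w)"
    using meas_norm total by (simp add: nn_integral_add nn_integral_cmult)
  finally show ?thesis .
qed

section \<open>Uniformity over both parameter families\<close>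

theorem theorem2:
  fixes X :: "(real ^ 'd) set"
    and \<Phi> :: "'p set"
    and \<Theta> :: "'q set"
    and f :: "'p \<Rightarrow> real ^ 'd \<Rightarrow> real ^ 'm"
    and \<omega> :: "'q \<Rightarrow> real ^ 'm \<Rightarrow> real"
    and P :: "(real ^ 'd) measure"
    and Ps :: "nat \<Rightarrow> (real ^ 'd) measure"
  assumes density: "\<And>\<eta>. \<eta> \<in> \<Theta> \<Longrightarrow> prob_density (\<omega> \<eta>)"
    and lipschitz: "\<exists>L. \<forall>\<phi>\<in>\<Phi>. L-lipschitz_on X (f \<phi>)"
    and moment: "(SUP \<eta>\<in>\<Theta>. \<integral>\<^sup>+ t. ennreal (norm t) \<partial>density_dist (\<omega> \<eta>)) < \<infinity>"
    and P: "prob_dist_on X P"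
    and Ps: "\<And>n. n \<ge> 1 \<Longrightarrow> prob_dist_on X (Ps n)"
    and conv: "weak_conv_on X Ps P"
  shows "(\<lambda>n. SUP (\<phi>, \<eta>)\<in>\<Phi> \<times> \<Theta>. cfd_sq (\<omega> \<eta>) (distr (Ps n) borel (f \<phi>)) (distr P borel (f \<phi>)))
           \<longlonglongrightarrow> 0"
proof -
  obtain L0 where "\<forall>\<phi>\<in>\<Phi>. L0-lipschitz_on X (f \<phi>)" using lipschitz by blast
  \<comment> \<open>For empty \<Phi> the constant \<open>L0\<close> may be negative; the absolute
    value covers that case.\<close>
  then have L: "\<bar>L0\<bar>-lipschitz_on X (f \<phi>)" if "\<phi> \<in> \<Phi>" for \<phi>
    using that by (auto intro: lipschitz_on_mono[OF _ order_refl])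
  define L where "L = \<bar>L0\<bar>"
  have "L \<ge> 0" by (simp add: L_def)
  define M where "M = enn2real (SUP \<eta>\<in>\<Theta>. \<integral>\<^sup>+ t. ennreal (norm t) \<partial>density_dist (\<omega> \<eta>))"
  have "M \<ge> 0" by (simp add: M_def)
  have M: "(\<integral>\<^sup>+ t. ennreal (norm t) \<partial>density_dist (\<omega> \<eta>)) \<le> ennreal M" if "\<eta> \<in> \<Theta>" for \<eta>
    using SUP_upper[OF that, of "\<lambda>\<eta>. \<integral>\<^sup>+ t. ennreal (norm t) \<partial>density_dist (\<omega> \<eta>)"] moment
    by (simp add: M_def)
  \<comment> \<open>Twice the integral of \<open>e * (1 + L * norm t)\<close> against a weight with
    first moment at most \<open>M\<close> is at most \<open>e * C\<close>.\<close>
  define C where "C = 2 * (1 + L * M)"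
  have "C > 0" using \<open>L \<ge> 0\<close> \<open>M \<ge> 0\<close> by (simp add: C_def add_pos_nonneg)
  have distr_prob: "prob_space (distr Q borel (f \<phi>))" and f_meas: "f \<phi> \<in> borel_measurable Q"
    if "prob_dist_on X Q" "\<phi> \<in> \<Phi>" for Q \<phi>
  proof -
    show "f \<phi> \<in> borel_measurable Q"
      using borel_measurable_prob_dist_on[OF that(1) lipschitz_on_continuous_on[OF L[OF that(2)]]] .
    then show "prob_space (distr Q borel (f \<phi>))"
      using that(1) by (auto simp: prob_dist_on_def intro: prob_space.prob_space_distr)
  qed
  have main: "\<forall>\<^sub>F n in sequentially.
      (SUP (\<phi>, \<eta>)\<in>\<Phi> \<times> \<Theta>. cfd_sq (\<omega> \<eta>) (distr (Ps n) borel (f \<phi>)) (distr P borel (f \<phi>)))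
        \<le> ennreal (e * C)" if "e > 0" for e
  proof -
    have "\<forall>\<^sub>F n in sequentially. \<forall>(g :: real ^ 'd \<Rightarrow> complex) K.
        K-lipschitz_on X g \<longrightarrow> (\<forall>x\<in>X. norm (g x) \<le> 1) \<longrightarrow>
        norm ((\<integral>x. g x \<partial>Ps n) - (\<integral>x. g x \<partial>P)) \<le> e * (1 + K)"
      by (rule weak_conv_on_uniform_lipschitz[OF P Ps conv that])
    then show ?thesis using eventually_ge_at_top[of 1]
    proof eventually_elim
      case (elim n)
      note Q = Ps[OF elim(2)]
      show ?case
      proof (rule SUP_least, clarify)
        fix \<phi> \<eta> assume \<phi>: "\<phi> \<in> \<Phi>" and \<eta>: "\<eta> \<in> \<Theta>"
        let ?Q = "distr (Ps n) borel (f \<phi>)" and ?R = "distr P borel (f \<phi>)"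
        \<comment> \<open>The test function is
          \<open>\<lambda>x. iexp (t \<bullet> f \<phi> x)\<close>, of modulus 1, with
          \<open>K = L * norm t\<close>; \<open>n\<close> was fixed before \<open>t\<close>, \<phi>
          and \<eta>.\<close>
        have "cmod (char_vec ?Q t - char_vec ?R t) \<le> e * (1 + L * norm t)" for t
          using elim(1) lipschitz_on_iexp_inner[OF L[OF \<phi>], of t]
          by (simp add: char_vec_distr f_meas[OF Q \<phi>] f_meas[OF P \<phi>] L_def)
        \<comment> \<open>Here \<open>a = e\<close> and \<open>b = e * L\<close> in
          \<open>cfd_sq_le\<close>.\<close>
        then have "cfd_sq (\<omega> \<eta>) ?Q ?R \<le> ennreal (2 * e)
            + ennreal (2 * (e * L)) * (\<integral>\<^sup>+ t. ennreal (norm t) \<partial>density_dist (\<omega> \<eta>))"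
          using \<open>e > 0\<close> \<open>L \<ge> 0\<close>
          by (intro cfd_sq_le density \<eta> distr_prob Q P \<phi>) (auto simp: algebra_simps)
        also have "\<dots> \<le> ennreal (2 * e) + ennreal (2 * (e * L)) * ennreal M"
          by (intro add_left_mono mult_left_mono M \<eta>) simp
        also have "\<dots> = ennreal (e * C)"
          using \<open>e > 0\<close> \<open>L \<ge> 0\<close> \<open>M \<ge> 0\<close>
          by (simp flip: ennreal_plus ennreal_mult add: C_def algebra_simps)
        finally show "cfd_sq (\<omega> \<eta>) ?Q ?R \<le> ennreal (e * C)" .
      qed
    qed
  qed
  show ?thesis
  proof (rule order_tendstoI)
    fix a :: ennreal assume "0 < a"
    \<comment> \<open>Since \<open>a\<close> may be infinite, an intermediate \<open>c\<close>,
      necessarily finite, supplies a real \<open>b\<close>; taking \<open>e = b / C\<close> makes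
      the bound \<open>ennreal b\<close>, strictly below \<open>a\<close>.\<close>
    then obtain c where c: "0 < c" "c < a" using dense by blast
    then obtain b where b: "0 < b" "ennreal b < a" by (cases c) auto
    then show "\<forall>\<^sub>F n in sequentially.
        (SUP (\<phi>, \<eta>)\<in>\<Phi> \<times> \<Theta>. cfd_sq (\<omega> \<eta>) (distr (Ps n) borel (f \<phi>)) (distr P borel (f \<phi>))) < a"
      using main[of "b / C"] \<open>C > 0\<close> by (auto elim!: eventually_mono)
  qed simp
qed

end
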